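(* Let $n\ge1$ and let $\mathbb{F}$ be a field with $\mathrm{char}(\mathbb{F})>n$. Suppose that $\beta\in\mathbb{F}\setminus\{0,\ldots,n\}$. Let $f\in\mathbb{F}[x_1,\ldots,x_n,y_1,\ldots,y_n]$ be a polynomial such that $$f(\overline{x},\overline{y})=\frac{1}{\sum_{i=1}^n x_iy_i-\beta}\qquad\text{for all }\overline{x},\overline{y}\in\{0,1\}^n.$$ Then $\dim\mathbf{Coeff}_{\overline{x}|\overline{y}}(f)\ge2^n$.
   Context: For $f\in\mathbb{F}[\overline{x},\overline{y}]$, write $f=\sum_{\overline{b}}f_{\overline{b}}(\overline{x})\,\overline{y}^{\overline{b}}$ with $f_{\overline{b}}\in\mathbb{F}[\overline{x}]$. Then $\mathbf{Coeff}_{\overline{x}|\overline{y}}(f)=\{f_{\overline{b}}\}_{\overline{b}}\subseteq\mathbb{F}[\overline{x}]$, and $\dim\mathbf{Coeff}_{\overline{x}|\overline{y}}(f)$ is the dimension of its $\mathbb{F}$-linear span (equivalently, the rank of the matrix of coefficients of $f$ with rows indexed by $\overline{x}$-monomials and columns by $\overline{y}$-monomials). The integers $0,\ldots,n$ are viewed as elements of $\mathbb{F}$. Convention: $\mathrm{char}(\mathbb{F})>n$ includes characteristic zero. *)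

theory Defs
  imports Complex_Main "HOL-Library.Poly_Mapping" "HOL-Library.FuncSet"
begin

text \<open>A polynomial ring with variables indexed by \<open>'v\<close> over \<open>'a\<close> is the type of finitely supported
  functions from exponent vectors to coefficients; its ring operations are those of
  \<^theory>\<open>HOL-Library.Poly_Mapping\<close>. Polynomials in two groups of variables use the index type
  \<open>'x + 'y\<close>: the variable \<open>x\<^sub>i\<close> is \<open>Inl i\<close> and the variable \<open>y\<^sub>j\<close> is \<open>Inr j\<close>.\<close>

type_synonym 'v monom = "'v \<Rightarrow>\<^sub>0 nat"
type_synonym ('v, 'a) mpoly = "'v monom \<Rightarrow>\<^sub>0 'a"

definition vars :: "('v, 'a::zero) mpoly \<Rightarrow> 'v set" where
  "vars p = (\<Union>m\<in>Poly_Mapping.keys p. Poly_Mapping.keys m)"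

definition mpoly_eval :: "('v \<Rightarrow> 'a) \<Rightarrow> ('v, 'a::comm_semiring_1) mpoly \<Rightarrow> 'a" where
  "mpoly_eval v p = (\<Sum>m\<in>Poly_Mapping.keys p.
     Poly_Mapping.lookup p m * (\<Prod>i\<in>Poly_Mapping.keys m. v i ^ Poly_Mapping.lookup m i))"

definition mpoly_scale :: "'a \<Rightarrow> ('v, 'a::field) mpoly \<Rightarrow> ('v, 'a) mpoly" where
  "mpoly_scale c p = Poly_Mapping.map (\<lambda>a. c * a) p"

lemma lookup_mpoly_scale [simp]:
  "Poly_Mapping.lookup (mpoly_scale c p) m = c * Poly_Mapping.lookup p m"
  unfolding mpoly_scale_def by (simp add: Poly_Mapping.map.rep_eq when_def)

global_interpretation mpoly: vector_space "mpoly_scale :: 'a::field \<Rightarrow> ('v, 'a) mpoly \<Rightarrow> ('v, 'a) mpoly"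
  by unfold_locales (auto intro!: poly_mapping_eqI simp: lookup_add algebra_simps)

text \<open>The monomial \<open>x\<^sup>a y\<^sup>b\<close>.\<close>

lift_definition xy_monom :: "'x monom \<Rightarrow> 'y monom \<Rightarrow> ('x + 'y) monom" is
  "\<lambda>a b. case_sum a b"
proof -
  fix a :: "'x \<Rightarrow> nat" and b :: "'y \<Rightarrow> nat"
  assume "finite {x. a x \<noteq> 0}" "finite {y. b y \<noteq> 0}"
  moreover have "{z. case_sum a b z \<noteq> 0} \<subseteq> Inl ` {x. a x \<noteq> 0} \<union> Inr ` {y. b y \<noteq> 0}"
  proof
    fix z assume "z \<in> {z. case_sum a b z \<noteq> 0}"
    then show "z \<in> Inl ` {x. a x \<noteq> 0} \<union> Inr ` {y. b y \<noteq> 0}" by (cases z) auto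
  qed
  ultimately show "finite {z. case_sum a b z \<noteq> 0}"
    by (meson finite_UnI finite_imageI finite_subset)
qed

lemma xy_monom_inject: "xy_monom a b = xy_monom a' b' \<longleftrightarrow> a = a' \<and> b = b'"
proof
  assume eq: "xy_monom a b = xy_monom a' b'"
  have "Poly_Mapping.lookup a i = Poly_Mapping.lookup a' i"
    and "Poly_Mapping.lookup b j = Poly_Mapping.lookup b' j" for i j
    using arg_cong[OF eq, of "\<lambda>m. Poly_Mapping.lookup m (Inl i)"]
      arg_cong[OF eq, of "\<lambda>m. Poly_Mapping.lookup m (Inr j)"]
    by (simp_all add: xy_monom.rep_eq)
  then show "a = a' \<and> b = b'" by (auto intro: poly_mapping_eqI)
qed simp

text \<open>The coefficient \<open>f\<^sub>b\<close>, a polynomial in the \<open>x\<close>-variables, of \<open>y\<^sup>b\<close> in \<open>f\<close>: the coefficient of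
  \<open>x\<^sup>a\<close> in \<open>f\<^sub>b\<close> is the coefficient of \<open>x\<^sup>a y\<^sup>b\<close> in \<open>f\<close>.\<close>

definition coeff_y :: "'y monom \<Rightarrow> ('x + 'y, 'a::zero) mpoly \<Rightarrow> ('x, 'a) mpoly" where
  "coeff_y b f = Poly_Mapping.map_key (\<lambda>a. xy_monom a b) f"

lemma lookup_coeff_y:
  "Poly_Mapping.lookup (coeff_y b f) a = Poly_Mapping.lookup f (xy_monom a b)"
  unfolding coeff_y_def
  by (subst Poly_Mapping.map_key.rep_eq) (auto simp: inj_def xy_monom_inject)

definition Coeff :: "('x + 'y, 'a::zero) mpoly \<Rightarrow> ('x, 'a) mpoly set" where
  "Coeff f = {coeff_y b f |b. True}"

definition x_to_xy :: "('x, 'a::comm_semiring_1) mpoly \<Rightarrow> ('x + 'y, 'a) mpoly" where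
  "x_to_xy p = (\<Sum>a\<in>Poly_Mapping.keys p.
     Poly_Mapping.single (xy_monom a 0) (Poly_Mapping.lookup p a))"

lemma xy_monom_add: "xy_monom a b + xy_monom a' b' = xy_monom (a + a') (b + b')"
  by (rule poly_mapping_eqI) (auto simp: lookup_add xy_monom.rep_eq split: sum.splits)

lemma xy_monom_surj: "\<exists>a b. m = xy_monom a b"
proof (intro exI)
  have "inj (Inl :: 'a \<Rightarrow> 'a + 'b)" "inj (Inr :: 'b \<Rightarrow> 'a + 'b)" by (auto simp: inj_def)
  then show "m = xy_monom (Poly_Mapping.map_key Inl m) (Poly_Mapping.map_key Inr m)"
    by (intro poly_mapping_eqI)
      (auto simp: xy_monom.rep_eq Poly_Mapping.map_key.rep_eq split: sum.splits)
qed

text \<open>The expansion \<open>f = (\<Sum>b. f\<^sub>b y\<^sup>b)\<close>, over any finite set of exponents containing those that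
  occur.\<close>

lemma coeff_y_expansion:
  fixes f :: "('x + 'y, 'a::comm_semiring_1) mpoly"
  assumes "finite B" and "\<And>b. coeff_y b f \<noteq> 0 \<Longrightarrow> b \<in> B"
  shows "f = (\<Sum>b\<in>B. x_to_xy (coeff_y b f) * Poly_Mapping.single (xy_monom 0 b) 1)"
proof (rule poly_mapping_eqI)
  fix m :: "('x + 'y) monom"
  obtain a b where m: "m = xy_monom a b" using xy_monom_surj by blast
  have coeff: "Poly_Mapping.lookup
      (x_to_xy (coeff_y c f) * Poly_Mapping.single (xy_monom 0 c) 1) m =
      (if c = b then Poly_Mapping.lookup f m else 0)" for c
  proof -
    have "Poly_Mapping.lookup
      (x_to_xy (coeff_y c f) * Poly_Mapping.single (xy_monom 0 c) 1) m =
      (\<Sum>a'\<in>Poly_Mapping.keys (coeff_y c f).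
         if a' = a then (if c = b then Poly_Mapping.lookup f m else 0) else 0)"
      unfolding x_to_xy_def sum_distrib_right Poly_Mapping.lookup_sum
      by (rule sum.cong)
        (auto simp: Poly_Mapping.mult_single xy_monom_add m lookup_single when_def
          xy_monom_inject lookup_coeff_y)
    also have "\<dots> = (if c = b then Poly_Mapping.lookup f m else 0)"
      by (auto simp: m lookup_coeff_y in_keys_iff)
    finally show ?thesis .
  qed
  have "Poly_Mapping.lookup f m = 0" if "b \<notin> B"
  proof -
    have "coeff_y b f = 0" using assms(2) that by blast
    then show ?thesis using lookup_coeff_y[of b f a] m by simp
  qed
  then show "Poly_Mapping.lookup f m = Poly_Mapping.lookup
      (\<Sum>b\<in>B. x_to_xy (coeff_y b f) * Poly_Mapping.single (xy_monom 0 b) 1) m"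
    using assms(1) by (auto simp: Poly_Mapping.lookup_sum coeff)
qed

end

theory Submission
  imports Defs
begin

text \<open>For \<open>T \<subseteq> {1..n}\<close> the polynomial \<open>f(x, 1\<^sub>T)\<close> lies in the span of \<open>Coeff f\<close>, hence so does the
  Moebius transform \<open>q\<^sub>W = (\<Sum>T \<subseteq> W. (-1)\<^bsup>|T|\<^esup> f(x, 1\<^sub>T))\<close>. Its value at \<open>x = 1\<^sub>S\<close> vanishes unless
  \<open>W \<subseteq> S\<close>, and its value at \<open>x = 1\<^sub>W\<close> is a finite difference of \<open>t \<mapsto> 1 / (t - \<beta>)\<close>, namely
  \<open>|W|! / (\<Prod>j\<le>|W|. j - \<beta>)\<close>, which is nonzero as the characteristic exceeds \<open>n\<close>. By triangularity the
  \<open>2\<^sup>n\<close> polynomials \<open>q\<^sub>W\<close> are linearly independent.\<close>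

section \<open>Linear algebra: bounding a dimension from below\<close>

text \<open>A repeated vector \<open>q i = q j\<close> would give the relation
  \<open>q i - q j = 0\<close> with nonzero coefficients. So independence of the indexed family
  makes \<open>q\<close> injective, and the image has as many elements as \<open>I\<close>.\<close>

lemma (in vector_space) card_le_dim_if_independent_family:
  assumes "finite I" "finite B" "q ` I \<subseteq> span B"
    and scalars: "\<And>c i. (\<Sum>i\<in>I. scale (c i) (q i)) = 0 \<Longrightarrow> i \<in> I \<Longrightarrow> c i = 0"
  shows "card I \<le> dim B"
proof -
  have inj: "inj_on q I"
  proof (rule inj_onI, rule ccontr)
    fix i j assume ij: "i \<in> I" "j \<in> I" "q i = q j" "i \<noteq> j"
    define c where "c k = (if k = i then 1 else if k = j then - 1 else 0 :: 'a)" for k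
    have "(\<Sum>k\<in>I. scale (c k) (q k)) = (\<Sum>k\<in>{i, j}. scale (c k) (q k))"
      using assms(1) ij by (intro sum.mono_neutral_right) (auto simp: c_def)
    also have "\<dots> = 0"
      using ij by (simp add: c_def)
    finally have "c i = 0"
      by (rule scalars) (rule ij(1))
    then show False by (simp add: c_def)
  qed
  have indep: "independent (q ` I)"
  proof (rule independent_if_scalars_zero)
    fix u v assume "(\<Sum>v\<in>q ` I. scale (u v) v) = 0" and "v \<in> q ` I"
    then show "u v = 0"
      using scalars[of "u \<circ> q"] by (auto simp: sum.reindex[OF inj])
  qed (use assms(1) in simp)
  obtain D where D: "D \<subseteq> B" "B \<subseteq> span D" "card D = dim B"
    by (rule basis_exists[of B])
  have "q ` I \<subseteq> span D"
    using assms(3) span_minimal[OF D(2) subspace_span] by (rule subset_trans)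
  then have "card (q ` I) \<le> card D"
    using independent_span_bound[OF finite_subset[OF D(1) assms(2)] indep] by simp
  then show ?thesis
    using D(3) by (simp add: card_image[OF inj])
qed

section \<open>Alternating sums over subsets\<close>

lemma sum_Pow_insert:
  fixes g :: "'a set \<Rightarrow> 'b::comm_monoid_add"
  assumes "finite A" "a \<notin> A"
  shows "(\<Sum>T\<in>Pow (insert a A). g T) = (\<Sum>T\<in>Pow A. g T + g (insert a T))"
proof -
  have "inj_on (insert a) (Pow A)"
    using assms(2) by (auto simp: inj_on_def)
  moreover have "Pow A \<inter> insert a ` Pow A = {}"
    using assms(2) by auto
  ultimately show ?thesis
    using assms(1) by (simp add: Pow_insert sum.union_disjoint sum.reindex sum.distrib)
qed

text \<open>Splitting the subsets by whether they contain \<open>a\<close> gives the sum for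
  \<open>\<gamma>\<close> minus the sum for \<open>\<gamma> + 1\<close>. The induction therefore has
  to generalize \<open>\<gamma>\<close>.\<close>

lemma alternating_sum_reciprocal:
  fixes \<gamma> :: "'a::field"
  assumes "finite W" "\<And>j. j \<le> card W \<Longrightarrow> \<gamma> + of_nat j \<noteq> 0"
  shows "(\<Sum>T\<in>Pow W. (- 1) ^ card T / (\<gamma> + of_nat (card T))) =
    of_nat (fact (card W)) / (\<Prod>j\<le>card W. \<gamma> + of_nat j)"
  using assms
proof (induction W arbitrary: \<gamma> rule: finite_induct)
  case (insert a W)
  let ?w = "card W"
  \<comment> \<open>\<open>P\<close> collects the factors shared by the two denominators: the one
    for \<open>\<gamma>\<close> adds the factor \<open>\<gamma>\<close>, the one for
    \<open>\<gamma> + 1\<close> adds \<open>\<gamma> + 1 + of_nat ?w\<close>. These differ by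
    \<open>?w + 1\<close>, which turns the factorial of \<open>?w\<close> into that of
    \<open>Suc ?w\<close>.\<close>
  define P where "P = (\<Prod>j<?w. \<gamma> + 1 + of_nat j)"
  have nz: "\<gamma> + of_nat j \<noteq> 0" if "j \<le> Suc ?w" for j
    using insert.prems that insert.hyps by simp
  have nz': "\<gamma> + 1 + of_nat j \<noteq> 0" if "j \<le> ?w" for j
    using nz[of "Suc j"] that by (simp add: add.assoc)
  have *: "\<gamma> \<noteq> 0" "\<gamma> + 1 + of_nat ?w \<noteq> 0" "P \<noteq> 0"
    using nz[of 0] nz' by (auto simp: P_def)
  have card_insert: "card (insert a T) = Suc (card T)" if "T \<in> Pow W" for T
    using that insert.hyps finite_subset by (metis PowD card_insert_disjoint subsetD)
  have P_low: "(\<Prod>j\<le>?w. \<gamma> + of_nat j) = \<gamma> * P"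
    by (simp add: P_def prod.atMost_shift add.assoc)
  have P_up: "(\<Prod>j\<le>?w. \<gamma> + 1 + of_nat j) = P * (\<gamma> + 1 + of_nat ?w)"
    by (simp add: P_def flip: lessThan_Suc_atMost)
  have P_all: "(\<Prod>j\<le>Suc ?w. \<gamma> + of_nat j) = \<gamma> * P * (\<gamma> + 1 + of_nat ?w)"
    by (simp add: P_low add.assoc)
  have "(\<Sum>T\<in>Pow (insert a W). (- 1) ^ card T / (\<gamma> + of_nat (card T))) =
      (\<Sum>T\<in>Pow W. (- 1) ^ card T / (\<gamma> + of_nat (card T))) -
      (\<Sum>T\<in>Pow W. (- 1) ^ card T / (\<gamma> + 1 + of_nat (card T)))"
    unfolding sum_Pow_insert[OF insert.hyps] sum_subtractf[symmetric]
    by (intro sum.cong) (simp_all add: card_insert add.assoc)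
  also have "\<dots> = of_nat (fact ?w) / (\<gamma> * P) - of_nat (fact ?w) / (P * (\<gamma> + 1 + of_nat ?w))"
    using insert.IH[of \<gamma>] insert.IH[of "\<gamma> + 1"] nz nz' by (simp add: P_low P_up)
  also have "\<dots> = of_nat (fact (Suc ?w)) / (\<gamma> * P * (\<gamma> + 1 + of_nat ?w))"
    using * by (simp add: divide_simps) (simp add: algebra_simps)
  finally show ?case
    using insert.hyps P_all by simp
qed simp

text \<open>The terms of \<open>T\<close> and \<open>insert a T\<close>, for \<open>T\<close>
  avoiding \<open>a\<close>, have opposite signs and cancel.\<close>

lemma alternating_sum_Pow_eq_0:
  fixes g :: "'a set \<Rightarrow> 'b::ring_1"
  assumes "finite W" "a \<in> W" "\<And>T. g (insert a T) = g T"
  shows "(\<Sum>T\<in>Pow W. (- 1) ^ card T * g T) = 0"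
proof -
  define V where "V = W - {a}"
  have V: "finite V" "a \<notin> V" "W = insert a V"
    using assms(1,2) by (auto simp: V_def)
  have "card (insert a T) = Suc (card T)" if "T \<in> Pow V" for T
    using that V finite_subset by (metis PowD card_insert_disjoint subsetD)
  then show ?thesis
    unfolding V(3) sum_Pow_insert[OF V(1,2)] by (intro sum.neutral) (auto simp: assms(3))
qed

text \<open>A positive characteristic exceeding \<open>n\<close> divides none of the factors
  \<open>1, ..., w\<close>.\<close>

lemma of_nat_fact_neq_0:
  assumes "CHAR('a::field) = 0 \<or> CHAR('a) > n" "w \<le> n"
  shows "(of_nat (fact w) :: 'a) \<noteq> 0"
proof -
  have "(of_nat k :: 'a) \<noteq> 0" if "k \<in> {1..w}" for k
    using assms that by (auto simp: of_nat_eq_0_iff_char_dvd dest: dvd_imp_le)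
  then show ?thesis
    by (simp add: fact_prod of_nat_prod)
qed

section \<open>Evaluation of polynomials in two groups of variables\<close>

definition monom_eval :: "('v \<Rightarrow> 'a::comm_semiring_1) \<Rightarrow> 'v monom \<Rightarrow> 'a" where
  "monom_eval v m = (\<Prod>i\<in>Poly_Mapping.keys m. v i ^ Poly_Mapping.lookup m i)"

text \<open>Allows polynomials with different supports to be summed over one common index
  set.\<close>

lemma mpoly_eval_superset:
  assumes "finite A" "Poly_Mapping.keys p \<subseteq> A"
  shows "mpoly_eval v p = (\<Sum>m\<in>A. Poly_Mapping.lookup p m * monom_eval v m)"
  unfolding mpoly_eval_def monom_eval_def
  using assms by (intro sum.mono_neutral_left) (auto simp: in_keys_iff)

lemma mpoly_eval_zero: "mpoly_eval v 0 = 0"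
  by (simp add: mpoly_eval_def)

lemma mpoly_eval_add: "mpoly_eval v (p + q) = mpoly_eval v p + mpoly_eval v q"
proof -
  let ?A = "Poly_Mapping.keys p \<union> Poly_Mapping.keys q"
  have "Poly_Mapping.keys (p + q) \<subseteq> ?A"
    by (rule Poly_Mapping.keys_add)
  then show ?thesis
    by (simp add: mpoly_eval_superset[of ?A] lookup_add sum.distrib ring_distribs)
qed

lemma mpoly_eval_scale: "mpoly_eval v (mpoly_scale c p) = c * mpoly_eval v p"
proof -
  have "Poly_Mapping.keys (mpoly_scale c p) \<subseteq> Poly_Mapping.keys p"
    by (auto simp: in_keys_iff)
  then show ?thesis
    by (simp add: mpoly_eval_superset[of "Poly_Mapping.keys p"] sum_distrib_left mult.assoc)
qed

lemma mpoly_eval_sum: "mpoly_eval v (\<Sum>i\<in>I. p i) = (\<Sum>i\<in>I. mpoly_eval v (p i))"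
  by (induction I rule: infinite_finite_induct) (simp_all add: mpoly_eval_zero mpoly_eval_add)

lemma monom_eval_xy_monom:
  "monom_eval (case_sum x y) (xy_monom a b) = monom_eval x a * monom_eval y b"
proof -
  have "Poly_Mapping.keys (xy_monom a b) = Inl ` Poly_Mapping.keys a \<union> Inr ` Poly_Mapping.keys b"
  proof (rule set_eqI)
    fix z
    show "z \<in> Poly_Mapping.keys (xy_monom a b) \<longleftrightarrow>
        z \<in> Inl ` Poly_Mapping.keys a \<union> Inr ` Poly_Mapping.keys b"
      by (cases z) (auto simp: in_keys_iff xy_monom.rep_eq)
  qed
  then show ?thesis
    unfolding monom_eval_def
    by (simp, subst prod.union_disjoint) (auto simp: prod.reindex xy_monom.rep_eq)
qed

lemma mpoly_eval_coeff_y: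
  fixes f :: "('x + 'y, 'a::field) mpoly"
  assumes "finite B" "\<And>b. coeff_y b f \<noteq> 0 \<Longrightarrow> b \<in> B"
  shows "mpoly_eval (case_sum x y) f = (\<Sum>b\<in>B. monom_eval y b * mpoly_eval x (coeff_y b f))"
proof -
  \<comment> \<open>The support of \<open>f\<close> is enlarged to a rectangle of exponent pairs,
    where the double sum can be swapped; the added pairs have coefficient 0.\<close>
  let ?A = "\<Union>b\<in>B. Poly_Mapping.keys (coeff_y b f)"
  let ?h = "\<lambda>(a, b). xy_monom a b"
  have fin: "finite ?A"
    using assms(1) by simp
  have "Poly_Mapping.keys f \<subseteq> ?h ` (?A \<times> B)"
  proof
    fix m assume m: "m \<in> Poly_Mapping.keys f"
    obtain a b where ab: "m = xy_monom a b"
      using xy_monom_surj by blast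
    then have a: "a \<in> Poly_Mapping.keys (coeff_y b f)"
      using m by (simp add: in_keys_iff lookup_coeff_y)
    then have "coeff_y b f \<noteq> 0"
      by auto
    then have "b \<in> B"
      by (rule assms(2))
    then show "m \<in> ?h ` (?A \<times> B)"
      using ab a by force
  qed
  moreover have "inj_on ?h (?A \<times> B)"
    by (auto simp: inj_on_def xy_monom_inject)
  ultimately have "mpoly_eval (case_sum x y) f =
      (\<Sum>(a, b)\<in>?A \<times> B. Poly_Mapping.lookup (coeff_y b f) a * (monom_eval x a * monom_eval y b))"
    using fin assms(1)
    by (subst mpoly_eval_superset[of "?h ` (?A \<times> B)"])
      (auto simp: sum.reindex lookup_coeff_y monom_eval_xy_monom intro!: sum.cong)
  also have "\<dots> = (\<Sum>b\<in>B. monom_eval y b *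
      (\<Sum>a\<in>?A. Poly_Mapping.lookup (coeff_y b f) a * monom_eval x a))"
    by (subst sum.cartesian_product[symmetric], subst sum.swap)
      (simp add: sum_distrib_left mult_ac)
  also have "\<dots> = (\<Sum>b\<in>B. monom_eval y b * mpoly_eval x (coeff_y b f))"
    using fin by (intro sum.cong refl) (subst mpoly_eval_superset[of ?A], auto)
  finally show ?thesis .
qed

text \<open>Each such \<open>b\<close> is the \<open>y\<close>-part of one of the finitely many
  exponents of \<open>f\<close>.\<close>

lemma finite_coeff_y_support: "finite {b. coeff_y b f \<noteq> 0}"
proof -
  have "{b. coeff_y b f \<noteq> 0} \<subseteq> Poly_Mapping.map_key Inr ` Poly_Mapping.keys f"
  proof
    fix b assume "b \<in> {b. coeff_y b f \<noteq> 0}"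
    then obtain a where "xy_monom a b \<in> Poly_Mapping.keys f"
      by (auto simp: poly_mapping_eq_iff fun_eq_iff lookup_coeff_y in_keys_iff)
    moreover have "Poly_Mapping.map_key Inr (xy_monom a b) = b"
      by (rule poly_mapping_eqI) (simp add: Poly_Mapping.map_key.rep_eq xy_monom.rep_eq)
    ultimately show "b \<in> Poly_Mapping.map_key Inr ` Poly_Mapping.keys f"
      by force
  qed
  then show ?thesis
    by (rule finite_subset) simp
qed

lemma finite_Coeff: "finite (Coeff f)"
proof -
  have "Coeff f \<subseteq> insert 0 ((\<lambda>b. coeff_y b f) ` {b. coeff_y b f \<noteq> 0})"
    by (auto simp: Coeff_def)
  then show ?thesis
    using finite_coeff_y_support finite_subset by blast
qed

text \<open>Fixing \<open>y\<close> turns \<open>f\<close> into the combination of its coefficients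
  \<open>coeff_y b f\<close> with scalars \<open>monom_eval y b\<close>.\<close>

lemma partial_eval_in_span_Coeff:
  fixes f :: "('x + 'y, 'a::field) mpoly"
  obtains p where "p \<in> mpoly.span (Coeff f)"
    and "\<And>x. mpoly_eval x p = mpoly_eval (case_sum x y) f"
proof
  let ?B = "{b. coeff_y b f \<noteq> 0}"
  let ?p = "\<Sum>b\<in>?B. mpoly_scale (monom_eval y b) (coeff_y b f)"
  show "?p \<in> mpoly.span (Coeff f)"
    by (intro mpoly.span_sum mpoly.span_scale mpoly.span_base) (auto simp: Coeff_def)
  show "mpoly_eval x ?p = mpoly_eval (case_sum x y) f" for x
    using mpoly_eval_coeff_y[of ?B f x y]
    by (simp add: mpoly_eval_sum mpoly_eval_scale finite_coeff_y_support)
qed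

section \<open>Triangularity of the Moebius transforms and the dimension bound\<close>

theorem proposition5p8:
  fixes n :: nat
    and \<beta> :: "'a::field"
    and f :: "(nat + nat, 'a) mpoly"
  assumes "n \<ge> 1"
    and "CHAR('a) = 0 \<or> CHAR('a) > n"
    and "\<beta> \<notin> of_nat ` {0..n}"
    and "vars f \<subseteq> Inl ` {1..n} \<union> Inr ` {1..n}"
    and "\<And>x y :: nat \<Rightarrow> 'a. x \<in> {1..n} \<rightarrow> {0, 1} \<Longrightarrow> y \<in> {1..n} \<rightarrow> {0, 1} \<Longrightarrow>
           mpoly_eval (case_sum x y) f = 1 / ((\<Sum>i=1..n. x i * y i) - \<beta>)"
  shows "mpoly.dim (mpoly.span (Coeff f)) \<ge> 2 ^ n"
proof -
  define ind :: "nat set \<Rightarrow> nat \<Rightarrow> 'a" where "ind S i = of_bool (i \<in> S)" for S i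
  let ?I = "Pow {1..n}"
  have "\<exists>p. p \<in> mpoly.span (Coeff f) \<and>
      (\<forall>x. mpoly_eval x p = mpoly_eval (case_sum x (ind T)) f)" for T
    using partial_eval_in_span_Coeff by metis
  then obtain p where p: "\<And>T. p T \<in> mpoly.span (Coeff f)"
      "\<And>T x. mpoly_eval x (p T) = mpoly_eval (case_sum x (ind T)) f"
    by metis
  define q where "q W = (\<Sum>T\<in>Pow W. mpoly_scale ((- 1) ^ card T) (p T))" for W
  have eval_p: "mpoly_eval (ind S) (p T) = 1 / (of_nat (card (S \<inter> T)) - \<beta>)" if "T \<in> ?I" for S T
  proof -
    have "mpoly_eval (ind S) (p T) = 1 / ((\<Sum>i=1..n. ind S i * ind T i) - \<beta>)"
      unfolding p(2) by (rule assms(5)) (auto simp: ind_def)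
    also have "(\<Sum>i=1..n. ind S i * ind T i) = of_nat (card ({1..n} \<inter> (S \<inter> T)))"
      by (simp add: ind_def Int_def flip: of_bool_conj)
    also have "{1..n} \<inter> (S \<inter> T) = S \<inter> T"
      using that by auto
    finally show ?thesis .
  qed
  have eval_q: "mpoly_eval (ind S) (q W) =
      (\<Sum>T\<in>Pow W. (- 1) ^ card T * (1 / (of_nat (card (S \<inter> T)) - \<beta>)))" if "W \<in> ?I" for S W
    unfolding q_def mpoly_eval_sum mpoly_eval_scale
    using that by (intro sum.cong refl) (subst eval_p, auto)
  have off_diag: "mpoly_eval (ind S) (q W) = 0" if W: "W \<in> ?I" "\<not> W \<subseteq> S" for S W
  proof -
    \<comment> \<open>Since \<open>a\<close> lies outside \<open>S\<close>, inserting it into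
      \<open>T\<close> leaves \<open>S \<inter> T\<close> unchanged, so the terms cancel in
      pairs.\<close>
    obtain a where "a \<in> W" "a \<notin> S"
      using W(2) by blast
    moreover have "finite W"
      using W(1) finite_subset by auto
    ultimately show ?thesis
      unfolding eval_q[OF W(1)] by (intro alternating_sum_Pow_eq_0[of W a]) auto
  qed
  have diag: "mpoly_eval (ind W) (q W) \<noteq> 0" if "W \<in> ?I" for W
  proof -
    have W: "finite W" "card W \<le> n"
      using that finite_subset card_mono[of "{1..n}" W] by auto
    \<comment> \<open>With \<open>\<gamma> = - \<beta>\<close>, no denominator vanishes because
      \<open>j \<le> n\<close> and \<beta> avoids \<open>0, ..., n\<close>.\<close>
    have nz: "- \<beta> + of_nat j \<noteq> 0" if "j \<le> card W" for j
      using assms(3) W(2) that by (auto simp: image_iff)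
    have "mpoly_eval (ind W) (q W) = (\<Sum>T\<in>Pow W. (- 1) ^ card T / (- \<beta> + of_nat (card T)))"
      unfolding eval_q[OF that] by (intro sum.cong) (auto simp: Int_absorb1)
    also have "\<dots> = of_nat (fact (card W)) / (\<Prod>j\<le>card W. - \<beta> + of_nat j)"
      using alternating_sum_reciprocal[OF W(1) nz] by simp
    also have "\<dots> \<noteq> 0"
      using nz of_nat_fact_neq_0[OF assms(2) W(2)] by auto
    finally show ?thesis .
  qed
  have "card ?I \<le> mpoly.dim (Coeff f)"
  proof (rule mpoly.card_le_dim_if_independent_family)
    show "q ` ?I \<subseteq> mpoly.span (Coeff f)"
      unfolding q_def by (auto intro!: mpoly.span_sum mpoly.span_scale p(1))
  next
    fix c W
    assume sum0: "(\<Sum>W\<in>?I. mpoly_scale (c W) (q W)) = 0" and "W \<in> ?I"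
    have "finite W"
      using \<open>W \<in> ?I\<close> finite_subset by auto
    then show "c W = 0"
      using \<open>W \<in> ?I\<close>
    \<comment> \<open>The relation is evaluated at the indicator of \<open>W\<close>. Terms with
      \<open>V\<close> not contained in \<open>W\<close> vanish by \<open>off_diag\<close>, those
      with \<open>V\<close> a proper subset by the induction hypothesis; \<open>diag\<close> then
      forces \<open>c W = 0\<close>.\<close>
    proof (induction W rule: finite_psubset_induct)
      case (psubset W)
      have "0 = mpoly_eval (ind W) (\<Sum>V\<in>?I. mpoly_scale (c V) (q V))"
        by (simp only: sum0 mpoly_eval_zero)
      also have "\<dots> = (\<Sum>V\<in>?I. c V * mpoly_eval (ind W) (q V))"
        by (simp add: mpoly_eval_sum mpoly_eval_scale)
      also have "\<dots> = (\<Sum>V\<in>{W}. c V * mpoly_eval (ind W) (q V))"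
      proof (intro sum.mono_neutral_right ballI)
        fix V assume "V \<in> ?I - {W}"
        then show "c V * mpoly_eval (ind W) (q V) = 0"
          using psubset.IH[of V] off_diag[of V W] by (cases "V \<subset> W") auto
      qed (use psubset.prems in auto)
      finally show ?case
        using diag[OF psubset.prems] by simp
    qed
  qed (simp_all add: finite_Coeff)
  then show ?thesis
    by (simp add: card_Pow mpoly.dim_span)
qed

end
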